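(* Let $n\to\infty$ and for $i=1,\ldots,k$ let $D_i$ be an $(m,n,\lambda_i)$-semiregular bipartite graph on $(V_1,V_2)$. Assume $m\le n$ and $m^{1/2}n\sum_{1\le i<j\le k}\lambda_i\lambda_j=o(1)$. Then the probability that $D_1,\ldots,D_k$ are pairwise edge-disjoint after each is labelled at random is \[ \exp\Bigl(-mn\sum_{1\le i<j\le k}\lambda_i\lambda_j+O\Bigl(m^{1/2}n\sum_{1\le i<j\le k}\lambda_i\lambda_j\Bigr)\Bigr). \]
   Context: All bipartite graphs have bipartition $(V_1,V_2)$ with $|V_1|=m$, $|V_2|=n$. An $(m,n,\lambda)$-semiregular bipartite graph has every degree in $V_1$ equal to $\lambda n$ and every degree in $V_2$ equal to $\lambda m$, with $0<\lambda\le 1$ and $\lambda m,\lambda n$ integers. Labelling a graph at random means applying a uniformly random pair of permutations of $V_1$ and of $V_2$ (all $m!\,n!$ possibilities equally likely), independently for each graph. *)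

theory Defs
  imports "HOL-Probability.Probability" "HOL-Probability.Product_PMF"
    "HOL-Library.Landau_Symbols" "HOL-Combinatorics.Permutations"
begin

text \<open>
  A bipartite graph on \<open>(V1, V2)\<close> is its set of edges, each written as a pair with the
  endpoint in \<open>V1\<close> first; the position in the pair keeps the two sides apart, so no disjointness of
  \<open>V1\<close> and \<open>V2\<close> is needed.
\<close>

definition bipartite_graph :: "'a set \<Rightarrow> 'b set \<Rightarrow> ('a \<times> 'b) set \<Rightarrow> bool" where
  "bipartite_graph V1 V2 D \<longleftrightarrow> finite V1 \<and> finite V2 \<and> D \<subseteq> V1 \<times> V2"

definition degree_left :: "('a \<times> 'b) set \<Rightarrow> 'a \<Rightarrow> nat" where
  "degree_left D u = card {v. (u, v) \<in> D}"

definition degree_right :: "('a \<times> 'b) set \<Rightarrow> 'b \<Rightarrow> nat" where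
  "degree_right D v = card {u. (u, v) \<in> D}"

definition semiregular_bipartite ::
    "'a set \<Rightarrow> 'b set \<Rightarrow> nat \<Rightarrow> nat \<Rightarrow> real \<Rightarrow> ('a \<times> 'b) set \<Rightarrow> bool" where
  "semiregular_bipartite V1 V2 m n l D \<longleftrightarrow>
     bipartite_graph V1 V2 D \<and> card V1 = m \<and> card V2 = n \<and>
     0 < l \<and> l \<le> 1 \<and> l * real m \<in> \<int> \<and> l * real n \<in> \<int> \<and>
     (\<forall>u\<in>V1. real (degree_left D u) = l * real n) \<and>
     (\<forall>v\<in>V2. real (degree_right D v) = l * real m)"

definition relabel :: "('a \<Rightarrow> 'a) \<times> ('b \<Rightarrow> 'b) \<Rightarrow> ('a \<times> 'b) set \<Rightarrow> ('a \<times> 'b) set" where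
  "relabel p D = map_prod (fst p) (snd p) ` D"

definition labelling_pmf :: "'a set \<Rightarrow> 'b set \<Rightarrow> (('a \<Rightarrow> 'a) \<times> ('b \<Rightarrow> 'b)) pmf" where
  "labelling_pmf V1 V2 = pmf_of_set ({\<sigma>. \<sigma> permutes V1} \<times> {\<tau>. \<tau> permutes V2})"

text \<open>
  The second argument of \<^const>\<open>Pi_pmf\<close> is only the value outside the index set \<open>{1..k}\<close>.
\<close>

definition edge_disjoint_prob ::
    "'a set \<Rightarrow> 'b set \<Rightarrow> nat \<Rightarrow> (nat \<Rightarrow> ('a \<times> 'b) set) \<Rightarrow> real" where
  "edge_disjoint_prob V1 V2 k D =
     measure_pmf.prob (Pi_pmf {1..k} undefined (\<lambda>_. labelling_pmf V1 V2))
       {\<omega>. disjoint_family_on (\<lambda>i. relabel (\<omega> i) (D i)) {1..k}}"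

definition pair_sum :: "nat \<Rightarrow> (nat \<Rightarrow> real) \<Rightarrow> real" where
  "pair_sum k l = (\<Sum>(i, j)\<in>{(i, j). 1 \<le> i \<and> i < j \<and> j \<le> k}. l i * l j)"

end

theory Submission
  imports Defs
begin

text \<open>
  The disjoint union of semiregular graphs is semiregular and the densities add, so it suffices to
  place the graphs one at a time: this reduces the claim to two graphs \<open>H\<close> and \<open>D\<close>, with errors that
  add up over the steps. For two graphs let \<open>N\<close> be the number of common edges,
  \<open>M = mn\<lambda>\<mu>\<close> its mean, and \<open>F y\<close> the sum of \<open>y ^ N\<close> over all labellings. Then
  \<open>F 0 / F 1\<close> is the probability of disjointness, and a differential inequality
  \<open>F' = (M + O(M / sqrt m)) F\<close> on \<open>[0, 1]\<close> gives the estimate. The derivative counts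
  labellings with a marked common edge; composing with a transposition on each side pairs them with
  unmarked labellings, and in all but a fraction \<open>O(1 / sqrt m)\<close> of the cases no other
  common edge changes in the unwanted direction.
\<close>

section \<open>Bipartite graphs with constant integer degrees on each side\<close>

text \<open>Natural-number degrees add under disjoint union, and degree zero is allowed, whereas
  \<open>semiregular_bipartite\<close> demands positive density: before the first step the graph
  already placed is empty.\<close>

definition biregular :: "'a set \<Rightarrow> 'b set \<Rightarrow> nat \<Rightarrow> nat \<Rightarrow> ('a \<times> 'b) set \<Rightarrow> bool" where
  "biregular V1 V2 d d' G \<longleftrightarrow> finite V1 \<and> finite V2 \<and> G \<subseteq> V1 \<times> V2 \<and>
     (\<forall>u\<in>V1. degree_left G u = d) \<and> (\<forall>v\<in>V2. degree_right G v = d')"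

lemma biregularD:
  assumes "biregular V1 V2 d d' G"
  shows "finite V1" "finite V2" "G \<subseteq> V1 \<times> V2" "finite G"
    "\<And>u v. (u, v) \<in> G \<Longrightarrow> u \<in> V1" "\<And>u v. (u, v) \<in> G \<Longrightarrow> v \<in> V2"
    "\<And>u. finite {v. (u, v) \<in> G}" "\<And>v. finite {u. (u, v) \<in> G}"
    "\<And>u. u \<in> V1 \<Longrightarrow> card {v. (u, v) \<in> G} = d"
    "\<And>v. v \<in> V2 \<Longrightarrow> card {u. (u, v) \<in> G} = d'"
proof -
  show 1: "finite V1" "finite V2" "G \<subseteq> V1 \<times> V2"
    using assms by (auto simp: biregular_def)
  then show "finite G" by (meson finite_SigmaI finite_subset)
  show "\<And>u v. (u, v) \<in> G \<Longrightarrow> u \<in> V1" "\<And>u v. (u, v) \<in> G \<Longrightarrow> v \<in> V2"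
    using 1 by auto
  show "finite {v. (u, v) \<in> G}" for u
    by (rule finite_subset[OF _ 1(2)]) (use 1 in auto)
  show "finite {u. (u, v) \<in> G}" for v
    by (rule finite_subset[OF _ 1(1)]) (use 1 in auto)
  show "\<And>u. u \<in> V1 \<Longrightarrow> card {v. (u, v) \<in> G} = d"
    "\<And>v. v \<in> V2 \<Longrightarrow> card {u. (u, v) \<in> G} = d'"
    using assms by (auto simp: biregular_def degree_left_def degree_right_def)
qed

lemma biregular_card:
  assumes "biregular V1 V2 d d' G"
  shows "card G = card V1 * d" "card G = card V2 * d'"
proof -
  note G = biregularD[OF assms]
  have "G = (SIGMA u:V1. {v. (u, v) \<in> G})" using G(3) by auto
  then have "card G = card (SIGMA u:V1. {v. (u, v) \<in> G})" by simp
  also have "\<dots> = card V1 * d" using G by (subst card_SigmaI) auto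
  finally show "card G = card V1 * d" .
  have "prod.swap ` G = (SIGMA v:V2. {u. (u, v) \<in> G})" using G(3) by force
  then have "card (prod.swap ` G) = card (SIGMA v:V2. {u. (u, v) \<in> G})" by simp
  also have "\<dots> = card V2 * d'" using G by (subst card_SigmaI) auto
  finally show "card G = card V2 * d'" by (simp add: card_image)
qed

text \<open>Counting the edges of each graph from both sides gives the equality. Both products are
  the mean number of common edges under a random labelling: for densities \<open>l\<close> and
  \<open>l'\<close> each equals \<open>m * n * l * l'\<close>.\<close>

lemma biregular_degree_products:
  assumes "biregular V1 V2 h h' H" "biregular V1 V2 d d' D" "V2 \<noteq> {}"
  shows "h * d' = h' * d"
proof -
  have "card V1 * h = card V2 * h'" "card V1 * d = card V2 * d'"
    using biregular_card[OF assms(1)] biregular_card[OF assms(2)] by auto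
  then have "card V2 * (h * d') = card V2 * (h' * d)"
    by (metis mult.commute mult.left_commute)
  moreover have "card V2 \<noteq> 0" using assms biregularD(2)[OF assms(1)] by auto
  ultimately show ?thesis by simp
qed

text \<open>The inverse image of \<open>D\<close> under the labelling. Keeping \<open>H\<close>
  fixed and moving \<open>D\<close> turns collisions into \<open>H \<inter> G\<close> with
  \<open>G\<close> again biregular, so bad switches can be counted for two fixed graphs.\<close>

definition pullback :: "'a set \<Rightarrow> 'b set \<Rightarrow> ('a \<Rightarrow> 'a) \<times> ('b \<Rightarrow> 'b) \<Rightarrow> ('a \<times> 'b) set \<Rightarrow> ('a \<times> 'b) set"
  where "pullback V1 V2 p D = {(u, v). u \<in> V1 \<and> v \<in> V2 \<and> (fst p u, snd p v) \<in> D}"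

lemma biregular_pullback:
  assumes D: "biregular V1 V2 d d' D" and p: "fst p permutes V1" "snd p permutes V2"
  shows "biregular V1 V2 d d' (pullback V1 V2 p D)"
proof -
  note D' = biregularD[OF D]
  have "degree_left (pullback V1 V2 p D) u = d" if "u \<in> V1" for u
  proof -
    have "snd p ` {v. (u, v) \<in> pullback V1 V2 p D} = {v. (fst p u, v) \<in> D}"
      using that D' permutes_image[OF p(2)] by (auto simp: pullback_def image_iff)
    then have "card (snd p ` {v. (u, v) \<in> pullback V1 V2 p D}) = d"
      using D'(9)[of "fst p u"] that permutes_in_image[OF p(1)] by simp
    then show ?thesis
      by (simp add: card_image degree_left_def permutes_inj_on[OF p(2)])
  qed
  moreover have "degree_right (pullback V1 V2 p D) v = d'" if "v \<in> V2" for v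
  proof -
    have "fst p ` {u. (u, v) \<in> pullback V1 V2 p D} = {u. (u, snd p v) \<in> D}"
      using that D' permutes_image[OF p(1)] by (auto simp: pullback_def image_iff)
    then have "card (fst p ` {u. (u, v) \<in> pullback V1 V2 p D}) = d'"
      using D'(10)[of "snd p v"] that permutes_in_image[OF p(2)] by simp
    then show ?thesis
      by (simp add: card_image degree_right_def permutes_inj_on[OF p(1)])
  qed
  ultimately show ?thesis using D' by (auto simp: biregular_def pullback_def)
qed

text \<open>Relabelling is the pullback along the inverse permutations.\<close>

lemma biregular_relabel:
  assumes D: "biregular V1 V2 d d' D" and p: "fst p permutes V1" "snd p permutes V2"
  shows "biregular V1 V2 d d' (relabel p D)"
proof -
  have "relabel p D = pullback V1 V2 (inv (fst p), inv (snd p)) D"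
  proof (intro set_eqI iffI; clarify)
    fix a b assume "(a, b) \<in> relabel p D"
    then show "(a, b) \<in> pullback V1 V2 (inv (fst p), inv (snd p)) D"
      using biregularD(5,6)[OF D] p
      by (auto simp: relabel_def pullback_def permutes_inverses permutes_in_image)
  next
    fix a b assume "(a, b) \<in> pullback V1 V2 (inv (fst p), inv (snd p)) D"
    then have "(inv (fst p) a, inv (snd p) b) \<in> D" by (simp add: pullback_def)
    then have "map_prod (fst p) (snd p) (inv (fst p) a, inv (snd p) b) \<in> relabel p D"
      unfolding relabel_def by (rule imageI)
    then show "(a, b) \<in> relabel p D" using p by (simp add: permutes_inverses)
  qed
  then show ?thesis
    using biregular_pullback[OF D, of "(inv (fst p), inv (snd p))"] p
    by (simp add: permutes_inv)
qed

lemma biregular_Un: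
  assumes "biregular V1 V2 d d' D" "biregular V1 V2 h h' H" "D \<inter> H = {}"
  shows "biregular V1 V2 (d + h) (d' + h') (D \<union> H)"
proof -
  note D = biregularD[OF assms(1)] and H = biregularD[OF assms(2)]
  have "degree_left (D \<union> H) u = d + h" if "u \<in> V1" for u
  proof -
    have "{v. (u, v) \<in> D \<union> H} = {v. (u, v) \<in> D} \<union> {v. (u, v) \<in> H}" by auto
    then show ?thesis unfolding degree_left_def
      using D(7,9)[of u] H(7,9)[of u] that assms(3) by (simp add: card_Un_disjnt disjnt_iff disjoint_iff)
  qed
  moreover have "degree_right (D \<union> H) v = d' + h'" if "v \<in> V2" for v
  proof -
    have "{u. (u, v) \<in> D \<union> H} = {u. (u, v) \<in> D} \<union> {u. (u, v) \<in> H}" by auto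
    then show ?thesis unfolding degree_right_def
      using D(8,10)[of v] H(8,10)[of v] that assms(3) by (simp add: card_Un_disjnt disjnt_iff disjoint_iff)
  qed
  ultimately show ?thesis using D H by (auto simp: biregular_def)
qed

section \<open>Counting the transpositions that spoil a switch\<close>

abbreviation swp :: "'a \<Rightarrow> 'a \<Rightarrow> 'a \<Rightarrow> 'a" where
  "swp \<equiv> Transposition.transpose"

text \<open>The transposition moves only edges at \<open>u\<close> and \<open>c\<close>. If no moved
  edge of \<open>H\<close> lands on \<open>G\<close>, then \<open>(u, v)\<close> is lost and nothing
  is gained. So a bad \<open>c\<close> ends a two-step walk from \<open>u\<close> with one edge in
  \<open>H\<close> and one in \<open>G\<close>, in either order.\<close>

lemma one_sided_switch_bad:
  assumes H: "biregular V1 V2 h h' H" and G: "biregular V1 V2 d d' G"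
    and uv: "(u, v) \<in> H" "(u, v) \<in> G"
  shows "card {c \<in> V1. \<not> card {x \<in> H. map_prod (swp u c) id x \<in> G} \<le> card (H \<inter> G) - 1}
    \<le> h * d' + h' * d" (is "card ?B \<le> _")
proof -
  note H' = biregularD[OF H] and G' = biregularD[OF G]
  \<comment> \<open>The trivial choice \<open>c = u\<close> is covered as well: it lies in
    \<open>B1\<close> through \<open>y = v\<close>.\<close>
  define B1 where "B1 = (\<Union>y\<in>{y. (u, y) \<in> H}. {c. (c, y) \<in> G})"
  define B2 where "B2 = (\<Union>y\<in>{y. (u, y) \<in> G}. {c. (c, y) \<in> H})"
  have u: "u \<in> V1" using uv H' by auto
  have "?B \<subseteq> B1 \<union> B2"
  proof (rule subsetI, rule ccontr)
    fix c assume c: "c \<in> ?B" and n: "c \<notin> B1 \<union> B2"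
    have n1: "(c, y) \<notin> G" if "(u, y) \<in> H" for y using n that by (auto simp: B1_def)
    have n2: "(u, y) \<notin> G" if "(c, y) \<in> H" for y using n that by (auto simp: B2_def)
    have "{x \<in> H. map_prod (swp u c) id x \<in> G} \<subseteq> (H \<inter> G) - {(u, v)}"
    proof (rule subsetI)
      fix x assume x: "x \<in> {x \<in> H. map_prod (swp u c) id x \<in> G}"
      obtain p q where pq: "x = (p, q)" by (cases x)
      have "(p, q) \<in> H" "(swp u c p, q) \<in> G" using x pq by auto
      then show "x \<in> (H \<inter> G) - {(u, v)}"
        using n1[of q] n2[of q] pq by (cases "p = u"; cases "p = c") auto
    qed
    then have "card {x \<in> H. map_prod (swp u c) id x \<in> G} \<le> card ((H \<inter> G) - {(u, v)})"
      by (intro card_mono) (use H' in auto)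
    also have "\<dots> = card (H \<inter> G) - 1" using uv H' by simp
    finally show False using c by simp
  qed
  moreover have "card B1 \<le> h * d'"
  proof -
    have "card B1 \<le> (\<Sum>y\<in>{y. (u, y) \<in> H}. card {c. (c, y) \<in> G})"
      unfolding B1_def by (rule card_UN_le) (use H' in auto)
    also have "\<dots> = (\<Sum>y\<in>{y. (u, y) \<in> H}. d')"
      by (rule sum.cong) (use H' G' in auto)
    finally show ?thesis using H'(9)[OF u] by simp
  qed
  moreover have "card B2 \<le> h' * d"
  proof -
    have "card B2 \<le> (\<Sum>y\<in>{y. (u, y) \<in> G}. card {c. (c, y) \<in> H})"
      unfolding B2_def by (rule card_UN_le) (use G' in auto)
    also have "\<dots> = (\<Sum>y\<in>{y. (u, y) \<in> G}. h')"
      by (rule sum.cong) (use H' G' in auto)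
    finally show ?thesis using G'(9)[OF u] by (simp add: mult.commute)
  qed
  moreover have "finite (B1 \<union> B2)" unfolding B1_def B2_def using H' G' by auto
  ultimately show ?thesis
    by (meson add_mono card_Un_le card_mono le_trans)
qed

text \<open>The switch carries \<open>(a, b)\<close> onto \<open>(c, e)\<close>, the one intended
  gain. A further gain is a moved edge of \<open>H\<close> landing on an edge of \<open>G\<close>
  outside \<open>H\<close>; this forces one of six small configurations, each counted by a product
  of degrees.\<close>

lemma two_sided_switch_bad:
  assumes H: "biregular V1 V2 h h' H" and G: "biregular V1 V2 d d' G"
  shows "card {((a, b), (c, e)). (a, b) \<in> H \<and> (c, e) \<in> G \<and>
      \<not> card {x \<in> H. map_prod (swp a c) (swp b e) x \<in> G} \<le> card (H \<inter> G) + 1}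
    \<le> 2 * (card V2 * h' * d' * h * d) + 2 * (card V1 * h * d * h' * d')
      + card V2 * h' * h' * d + card V1 * h * h * d'" (is "card ?B \<le> _")
proof -
  note H' = biregularD[OF H] and G' = biregularD[OF G]
  define HL GL where "HL u = {v. (u, v) \<in> H}" and "GL u = {v. (u, v) \<in> G}" for u
  define HR GR where "HR v = {u. (u, v) \<in> H}" and "GR v = {u. (u, v) \<in> G}" for v
  note defs = HL_def GL_def HR_def GR_def
  have fin: "finite (HL u)" "finite (GL u)" "finite (HR v)" "finite (GR v)" for u v
    using H' G' by (auto simp: defs)
  have card: "u \<in> V1 \<Longrightarrow> card (HL u) = h" "u \<in> V1 \<Longrightarrow> card (GL u) = d"
    "v \<in> V2 \<Longrightarrow> card (HR v) = h'" "v \<in> V2 \<Longrightarrow> card (GR v) = d'" for u v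
    using H' G' by (auto simp: defs)
  have mem: "v \<in> HL u \<Longrightarrow> v \<in> V2" "v \<in> GL u \<Longrightarrow> v \<in> V2"
    "u \<in> HR v \<Longrightarrow> u \<in> V1" "u \<in> GR v \<Longrightarrow> u \<in> V1" for u v
    using H' G' by (auto simp: defs)
  \<comment> \<open>In every tuple each vertex after the first is a neighbour of an earlier one, so
    the sizes are exact products. In \<open>S1\<close> to \<open>S4\<close> the first vertex is
    joined to both members of a swapped pair, once in \<open>H\<close> and once in \<open>G\<close>;
    \<open>S5\<close> and \<open>S6\<close> describe an edge of \<open>H\<close> at
    \<open>(c, b)\<close> or \<open>(a, e)\<close>. The maps \<open>f1\<close> to \<open>f6\<close>
    restore the order and drop the extra vertex where there is one.\<close>
  define S1 where "S1 = (SIGMA y:V2. SIGMA c:HR y. SIGMA a:GR y. HL a \<times> GL c)"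
  define S2 where "S2 = (SIGMA y:V2. SIGMA a:HR y. SIGMA c:GR y. HL a \<times> GL c)"
  define S3 where "S3 = (SIGMA x:V1. SIGMA e:HL x. SIGMA b:GL x. HR b \<times> GR e)"
  define S4 where "S4 = (SIGMA x:V1. SIGMA b:HL x. SIGMA e:GL x. HR b \<times> GR e)"
  define S5 where "S5 = (SIGMA b:V2. SIGMA a:HR b. SIGMA c:HR b. GL c)"
  define S6 where "S6 = (SIGMA a:V1. SIGMA b:HL a. SIGMA e:HL a. GR e)"
  define f1 :: "'b \<times> 'a \<times> 'a \<times> 'b \<times> 'b \<Rightarrow> _" where "f1 = (\<lambda>(y, c, a, b, e). ((a, b), (c, e)))"
  define f2 :: "'b \<times> 'a \<times> 'a \<times> 'b \<times> 'b \<Rightarrow> _" where "f2 = (\<lambda>(y, a, c, b, e). ((a, b), (c, e)))"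
  define f3 :: "'a \<times> 'b \<times> 'b \<times> 'a \<times> 'a \<Rightarrow> _" where "f3 = (\<lambda>(x, e, b, a, c). ((a, b), (c, e)))"
  define f4 :: "'a \<times> 'b \<times> 'b \<times> 'a \<times> 'a \<Rightarrow> _" where "f4 = (\<lambda>(x, b, e, a, c). ((a, b), (c, e)))"
  define f5 :: "'b \<times> 'a \<times> 'a \<times> 'b \<Rightarrow> _" where "f5 = (\<lambda>(b, a, c, e). ((a, b), (c, e)))"
  define f6 :: "'a \<times> 'b \<times> 'b \<times> 'a \<Rightarrow> _" where "f6 = (\<lambda>(a, b, e, c). ((a, b), (c, e)))"
  have finS: "finite S1" "finite S2" "finite S3" "finite S4" "finite S5" "finite S6"
    unfolding S1_def S2_def S3_def S4_def S5_def S6_def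
    using fin H'(1,2) by (auto intro!: finite_SigmaI)
  have cardS: "card S1 = card V2 * h' * d' * h * d" "card S2 = card V2 * h' * d' * h * d"
    "card S3 = card V1 * h * d * h' * d'" "card S4 = card V1 * h * d * h' * d'"
    "card S5 = card V2 * h' * h' * d" "card S6 = card V1 * h * h * d'"
    unfolding S1_def S2_def S3_def S4_def S5_def S6_def
    using fin H'(1,2) mem
    by (simp_all add: card_SigmaI finite_SigmaI card cong: sum.cong)
  have "?B \<subseteq> f1 ` S1 \<union> f2 ` S2 \<union> f3 ` S3 \<union> f4 ` S4 \<union> f5 ` S5 \<union> f6 ` S6"
  proof (rule subsetI, rule ccontr)
    fix w assume w: "w \<in> ?B"
      and n: "w \<notin> f1 ` S1 \<union> f2 ` S2 \<union> f3 ` S3 \<union> f4 ` S4 \<union> f5 ` S5 \<union> f6 ` S6"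
    obtain a b c e where abce: "w = ((a, b), (c, e))" by (metis prod.exhaust)
    have ab: "(a, b) \<in> H" and ce: "(c, e) \<in> G"
      and gt: "\<not> card {x \<in> H. map_prod (swp a c) (swp b e) x \<in> G} \<le> card (H \<inter> G) + 1"
      using w unfolding abce mem_Collect_eq prod.case by blast+
    have n2: "((a, b), (c, e)) \<notin> f6 ` S6" "((a, b), (c, e)) \<notin> f5 ` S5"
        "((a, b), (c, e)) \<notin> f4 ` S4" "((a, b), (c, e)) \<notin> f3 ` S3"
        "((a, b), (c, e)) \<notin> f2 ` S2"
      and n1: "((a, b), (c, e)) \<notin> f1 ` S1"
      using n unfolding abce Un_iff de_Morgan_disj by metis+
    let ?X = "{x \<in> H. map_prod (swp a c) (swp b e) x \<in> G}"
    \<comment> \<open>The pair of transpositions is injective, so \<open>?X\<close> may be counted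
      by its image; an image inside \<open>insert (c, e) (H \<inter> G)\<close> would be too small
      for a bad pair.\<close>
    have "card (map_prod (swp a c) (swp b e) ` ?X) = card ?X"
      by (intro card_image inj_on_subset[OF prod.inj_map]) auto
    moreover have "card (map_prod (swp a c) (swp b e) ` ?X) \<le> card (insert (c, e) (H \<inter> G))"
      if "map_prod (swp a c) (swp b e) ` ?X \<subseteq> insert (c, e) (H \<inter> G)"
      by (rule card_mono[OF _ that]) (use H' in auto)
    moreover have "card (insert (c, e) (H \<inter> G)) \<le> card (H \<inter> G) + 1"
      using H' by (simp add: card_insert_if)
    ultimately have ns: "\<not> map_prod (swp a c) (swp b e) ` ?X \<subseteq> insert (c, e) (H \<inter> G)"
      using gt by linarith
    have "\<exists>z\<in>?X. map_prod (swp a c) (swp b e) z \<notin> insert (c, e) (H \<inter> G)"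
    proof (rule ccontr)
      assume n: "\<not> (\<exists>z\<in>?X. map_prod (swp a c) (swp b e) z \<notin> insert (c, e) (H \<inter> G))"
      have "map_prod (swp a c) (swp b e) ` ?X \<subseteq> insert (c, e) (H \<inter> G)"
      proof (rule image_subsetI)
        fix z assume "z \<in> ?X"
        with n show "map_prod (swp a c) (swp b e) z \<in> insert (c, e) (H \<inter> G)" by meson
      qed
      with ns show False by contradiction
    qed
    then obtain z where z: "z \<in> ?X" "map_prod (swp a c) (swp b e) z \<notin> insert (c, e) (H \<inter> G)"
      by (elim bexE)
    obtain p q where zpq: "z = (p, q)" by (cases z)
    have pq: "(p, q) \<in> H" "(swp a c p, swp b e q) \<in> G"
      "(swp a c p, swp b e q) \<noteq> (c, e)" "(swp a c p, swp b e q) \<notin> H"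
      using z unfolding zpq map_prod_simp mem_Collect_eq insert_iff Int_iff by metis+
    define x y where "x = swp a c p" and "y = swp b e q"
    have p: "p = swp a c x" and q: "q = swp b e y" by (auto simp: x_def y_def)
    have xy: "(swp a c x, swp b e y) \<in> H" "(x, y) \<in> G" "(x, y) \<noteq> (c, e)" "(x, y) \<notin> H"
      using pq p q unfolding x_def[symmetric] y_def[symmetric] by auto
    have V: "a \<in> V1" "c \<in> V1" "b \<in> V2" "e \<in> V2" "x \<in> V1" "y \<in> V2"
      using ab ce xy H' G' by auto
    have N1: "\<not> ((c, y) \<in> H \<and> (a, y) \<in> G)"
    proof
      assume "(c, y) \<in> H \<and> (a, y) \<in> G"
      then have "(y, c, a, b, e) \<in> S1" using ab ce V by (auto simp: S1_def defs)
      then have "f1 (y, c, a, b, e) \<in> f1 ` S1" by (rule imageI)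
      then show False using n1 by (simp add: f1_def)
    qed
    have N2: "\<not> ((a, y) \<in> H \<and> (c, y) \<in> G)"
    proof
      assume "(a, y) \<in> H \<and> (c, y) \<in> G"
      then have "(y, a, c, b, e) \<in> S2" using ab ce V by (auto simp: S2_def defs)
      then have "f2 (y, a, c, b, e) \<in> f2 ` S2" by (rule imageI)
      then show False using n2 by (simp add: f2_def)
    qed
    have N3: "\<not> ((x, e) \<in> H \<and> (x, b) \<in> G)"
    proof
      assume "(x, e) \<in> H \<and> (x, b) \<in> G"
      then have "(x, e, b, a, c) \<in> S3" using ab ce V by (auto simp: S3_def defs)
      then have "f3 (x, e, b, a, c) \<in> f3 ` S3" by (rule imageI)
      then show False using n2 by (simp add: f3_def)
    qed
    have N4: "\<not> ((x, b) \<in> H \<and> (x, e) \<in> G)"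
    proof
      assume "(x, b) \<in> H \<and> (x, e) \<in> G"
      then have "(x, b, e, a, c) \<in> S4" using ab ce V by (auto simp: S4_def defs)
      then have "f4 (x, b, e, a, c) \<in> f4 ` S4" by (rule imageI)
      then show False using n2 by (simp add: f4_def)
    qed
    have N5: "(c, b) \<notin> H"
    proof
      assume "(c, b) \<in> H"
      then have "(b, a, c, e) \<in> S5" using ab ce V by (auto simp: S5_def defs)
      then have "f5 (b, a, c, e) \<in> f5 ` S5" by (rule imageI)
      then show False using n2 by (simp add: f5_def)
    qed
    have N6: "(a, e) \<notin> H"
    proof
      assume "(a, e) \<in> H"
      then have "(a, b, e, c) \<in> S6" using ab ce V by (auto simp: S6_def defs)
      then have "f6 (a, b, e, c) \<in> f6 ` S6" by (rule imageI)
      then show False using n2 by (simp add: f6_def)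
    qed
    \<comment> \<open>A position away from both swapped pairs is fixed, hence in \<open>H\<close>.
      One coordinate in a swapped pair leads to \<open>N1\<close> to \<open>N4\<close>. If both are,
      \<open>(c, e)\<close> is excluded, \<open>(a, b)\<close> is in \<open>H\<close>, and the
      positions \<open>(a, e)\<close> and \<open>(c, b)\<close> come from \<open>(c, b)\<close> and
      \<open>(a, e)\<close>, which \<open>N5\<close> and \<open>N6\<close> rule out.\<close>
    show False
    proof (cases "x = a \<or> x = c"; cases "y = b \<or> y = e")
      assume "\<not> (x = a \<or> x = c)" "\<not> (y = b \<or> y = e)"
      then show False using xy by simp
    next
      assume "\<not> (x = a \<or> x = c)" "y = b \<or> y = e"
      then show False using xy N3 N4 by auto
    next
      assume "x = a \<or> x = c" "\<not> (y = b \<or> y = e)"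
      then show False using xy N1 N2 by auto
    next
      assume "x = a \<or> x = c" "y = b \<or> y = e"
      then show False using xy N5 N6 ab by auto
    qed
  qed
  then have "card ?B \<le> card (f1 ` S1 \<union> f2 ` S2 \<union> f3 ` S3 \<union> f4 ` S4 \<union> f5 ` S5 \<union> f6 ` S6)"
    by (intro card_mono) (use finS in auto)
  also have "\<dots> \<le> card S1 + card S2 + card S3 + card S4 + card S5 + card S6"
    using finS by (intro order_trans[OF card_Un_le] add_mono card_image_le)
  finally show ?thesis unfolding cardS by simp
qed

section \<open>Switching labellings and double counting of marked common edges\<close>

definition labellings :: "'a set \<Rightarrow> 'b set \<Rightarrow> (('a \<Rightarrow> 'a) \<times> ('b \<Rightarrow> 'b)) set" where
  "labellings V1 V2 = {\<sigma>. \<sigma> permutes V1} \<times> {\<tau>. \<tau> permutes V2}"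

text \<open>Common edges are recorded at their place in \<open>H\<close> before relabelling, where
  the transpositions of a switch act.\<close>

definition common :: "('a \<times> 'b) set \<Rightarrow> ('a \<times> 'b) set \<Rightarrow> ('a \<Rightarrow> 'a) \<times> ('b \<Rightarrow> 'b) \<Rightarrow> ('a \<times> 'b) set" where
  "common H D p = {x \<in> H. map_prod (fst p) (snd p) x \<in> D}"

text \<open>The transpositions act before \<open>p\<close>, so after the switch \<open>x\<close>
  lands where \<open>p\<close> sent \<open>z\<close>.\<close>

definition switch :: "'a \<times> 'b \<Rightarrow> 'a \<times> 'b \<Rightarrow> ('a \<Rightarrow> 'a) \<times> ('b \<Rightarrow> 'b) \<Rightarrow> ('a \<Rightarrow> 'a) \<times> ('b \<Rightarrow> 'b)" where
  "switch x z p = (fst p \<circ> swp (fst x) (fst z), snd p \<circ> swp (snd x) (snd z))"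

lemma finite_labellings: "finite V1 \<Longrightarrow> finite V2 \<Longrightarrow> finite (labellings V1 V2)"
  by (simp add: labellings_def finite_permutations)

lemma labellings_nonempty: "labellings V1 V2 \<noteq> {}"
proof -
  have "(id, id) \<in> labellings V1 V2" by (simp add: labellings_def permutes_id)
  then show ?thesis by blast
qed

lemma labellingsD: "p \<in> labellings V1 V2 \<Longrightarrow> fst p permutes V1"
  "p \<in> labellings V1 V2 \<Longrightarrow> snd p permutes V2"
  by (auto simp: labellings_def)

lemma switch_switch: "switch x z (switch x z p) = p"
  by (simp add: switch_def comp_assoc)

lemma switch_in_labellings:
  assumes "x \<in> V1 \<times> V2" "z \<in> V1 \<times> V2" "p \<in> labellings V1 V2"
  shows "switch x z p \<in> labellings V1 V2"
  using assms by (auto simp: switch_def labellings_def intro!: permutes_compose permutes_swap_id)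

text \<open>A switch is an involution on the labellings. This substitution trades a mark on one edge
  for a mark on the other in both double counts.\<close>

lemma sum_labellings_switch:
  assumes "x \<in> V1 \<times> V2" "z \<in> V1 \<times> V2"
  shows "(\<Sum>p\<in>labellings V1 V2. g (switch x z p)) = (\<Sum>p\<in>labellings V1 V2. g p)"
  by (rule sum.reindex_bij_witness[of _ "switch x z" "switch x z"])
    (use assms in \<open>auto simp: switch_switch switch_in_labellings\<close>)

lemma common_eq_pullback:
  assumes "H \<subseteq> V1 \<times> V2"
  shows "common H D p = H \<inter> pullback V1 V2 p D"
  using assms by (auto simp: common_def pullback_def)

text \<open>Brings the common edges after a switch into the form in which the bad sets were
  counted.\<close>

lemma common_switch_eq:
  assumes "H \<subseteq> V1 \<times> V2" "x \<in> V1 \<times> V2" "z \<in> V1 \<times> V2"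
  shows "common H D (switch x z p) =
    {w \<in> H. map_prod (swp (fst x) (fst z)) (swp (snd x) (snd z)) w \<in> pullback V1 V2 p D}"
proof -
  have "swp (fst x) (fst z) u \<in> V1 \<longleftrightarrow> u \<in> V1" for u
    using assms by (intro permutes_in_image permutes_swap_id) auto
  moreover have "swp (snd x) (snd z) v \<in> V2 \<longleftrightarrow> v \<in> V2" for v
    using assms by (intro permutes_in_image permutes_swap_id) auto
  ultimately show ?thesis
    using subsetD[OF assms(1)] by (fastforce simp: common_def pullback_def switch_def)
qed

lemma map_prod_switch: "map_prod (fst (switch x z p)) (snd (switch x z p)) x = map_prod (fst p) (snd p) z"
  by (cases x) (simp add: switch_def map_prod_def split_beta)

text \<open>Switching away from a common edge: moving only its left endpoint by a transposition loses that
  edge and, for all but few transpositions, creates no new one. Moving one endpoint is enough here,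
  and it keeps the bad set small for every labelling.\<close>

lemma common_deriv_le:
  fixes y :: real and H D :: "('a \<times> 'b) set"
  assumes H: "biregular V1 V2 h h' H" and D: "biregular V1 V2 d d' D"
    and y: "0 \<le> y" "y \<le> 1"
  shows "(real (card V1) - real (h * d' + h' * d)) *
      (\<Sum>p\<in>labellings V1 V2. real (card (common H D p)) * y ^ (card (common H D p) - 1))
    \<le> real (card V1 * h * d') * (\<Sum>p\<in>labellings V1 V2. y ^ card (common H D p))"
proof -
  note H' = biregularD[OF H] and D' = biregularD[OF D]
  define \<Omega> where "\<Omega> = labellings V1 V2"
  define N where "N p = card (common H D p)" for p
  define on :: "('a \<Rightarrow> 'a) \<times> ('b \<Rightarrow> 'b) \<Rightarrow> 'a \<times> 'b \<Rightarrow> real"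
    where "on p x = of_bool (map_prod (fst p) (snd p) x \<in> D)" for p x
  define K where "K = real (card V1) - real (h * d' + h' * d)"
  define S :: "'a \<times> 'b \<Rightarrow> 'a \<Rightarrow> _" where "S x c = switch x (c, snd x)" for x c
  have N_on: "(\<Sum>x\<in>H. on p x * a) = real (N p) * a" for p a
  proof -
    have "(\<Sum>x\<in>H. on p x * a) = (\<Sum>x\<in>H \<inter> {x. map_prod (fst p) (snd p) x \<in> D}. a)"
      using H'(4) unfolding on_def by (rule sum_of_bool_mult_eq)
    also have "H \<inter> {x. map_prod (fst p) (snd p) x \<in> D} = common H D p"
      by (auto simp: common_def)
    finally show ?thesis by (simp add: N_def)
  qed
  \<comment> \<open>Every \<open>c\<close> outside the bad set leaves at most \<open>N p - 1\<close>
    common edges, and for \<open>y\<close> in the unit interval a smaller exponent gives a larger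
    power. At least \<open>K\<close> choices of \<open>c\<close> are of this kind.\<close>
  have key: "on p x * (K * y ^ (N p - 1)) \<le> on p x * (\<Sum>c\<in>V1. y ^ N (S x c p))"
    if p: "p \<in> \<Omega>" and x: "x \<in> H" for p x
  proof (cases "map_prod (fst p) (snd p) x \<in> D")
    case True
    define G where "G = pullback V1 V2 p D"
    have G: "biregular V1 V2 d d' G"
      unfolding G_def using p by (intro biregular_pullback D) (auto simp: \<Omega>_def labellingsD)
    obtain u v where uv: "x = (u, v)" by (cases x)
    have uvG: "(u, v) \<in> G" using True x H' uv by (auto simp: G_def pullback_def)
    define B where "B = {c \<in> V1. \<not> card {x \<in> H. map_prod (swp u c) id x \<in> G} \<le> card (H \<inter> G) - 1}"
    have cB: "card B \<le> h * d' + h' * d"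
      unfolding B_def using one_sided_switch_bad[OF H G] x uv uvG by auto
    have Nc: "N (S x c p) = card {x \<in> H. map_prod (swp u c) id x \<in> G}" if "c \<in> V1" for c
      unfolding N_def S_def G_def using that x uv H'
      by (subst common_switch_eq[of H V1 V2]) auto
    have Np: "N p = card (H \<inter> G)"
      unfolding N_def G_def using H'(3) by (simp add: common_eq_pullback)
    have "K \<le> real (card (V1 - B))"
    proof -
      have "card V1 \<le> card (V1 - B) + card B"
      proof -
        have "V1 = (V1 - B) \<union> B" by (auto simp: B_def)
        then show ?thesis by (metis card_Un_le)
      qed
      then show ?thesis using cB unfolding K_def by linarith
    qed
    then have "K * y ^ (N p - 1) \<le> real (card (V1 - B)) * y ^ (N p - 1)"
      using y by (intro mult_right_mono) auto
    also have "\<dots> = (\<Sum>c\<in>V1 - B. y ^ (N p - 1))" by simp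
    also have "\<dots> \<le> (\<Sum>c\<in>V1 - B. y ^ N (S x c p))"
      using y by (intro sum_mono power_decreasing) (auto simp: Nc Np B_def)
    also have "\<dots> \<le> (\<Sum>c\<in>V1. y ^ N (S x c p))"
      using y H' by (intro sum_mono2) auto
    finally show ?thesis by (simp add: on_def True)
  qed (simp add: on_def)
  \<comment> \<open>The sum over \<open>x\<close> marks a common edge. Labellings without common
    edges carry no mark, so the truncated exponent \<open>N p - 1\<close> does no harm.\<close>
  have "K * (\<Sum>p\<in>\<Omega>. real (N p) * y ^ (N p - 1)) = (\<Sum>p\<in>\<Omega>. \<Sum>x\<in>H. on p x * (K * y ^ (N p - 1)))"
    unfolding N_on by (simp add: sum_distrib_left mult_ac)
  also have "\<dots> \<le> (\<Sum>p\<in>\<Omega>. \<Sum>x\<in>H. on p x * (\<Sum>c\<in>V1. y ^ N (S x c p)))"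
    by (intro sum_mono key)
  also have "\<dots> = (\<Sum>x\<in>H. \<Sum>p\<in>\<Omega>. \<Sum>c\<in>V1. on p x * y ^ N (S x c p))"
    by (subst sum.swap) (simp add: sum_distrib_left)
  also have "\<dots> = (\<Sum>x\<in>H. \<Sum>c\<in>V1. \<Sum>p\<in>\<Omega>. on p x * y ^ N (S x c p))"
    by (rule sum.cong[OF refl], rule sum.swap)
  \<comment> \<open>Substituting the switched labelling for \<open>p\<close> removes the switch from
    the exponent and puts it into the mark.\<close>
  also have "\<dots> = (\<Sum>x\<in>H. \<Sum>c\<in>V1. \<Sum>p\<in>\<Omega>. on (S x c p) x * y ^ N p)"
  proof (rule sum.cong[OF refl], rule sum.cong[OF refl])
    fix x c assume x: "x \<in> H" and c: "c \<in> V1"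
    have "(\<Sum>p\<in>\<Omega>. on (S x c (S x c p)) x * y ^ N (S x c p)) = (\<Sum>p\<in>\<Omega>. on (S x c p) x * y ^ N p)"
      unfolding \<Omega>_def S_def
      by (rule sum_labellings_switch) (use x c H'(3) in auto)
    then show "(\<Sum>p\<in>\<Omega>. on p x * y ^ N (S x c p)) = (\<Sum>p\<in>\<Omega>. on (S x c p) x * y ^ N p)"
      by (simp add: S_def switch_switch)
  qed
  also have "\<dots> = (\<Sum>x\<in>H. \<Sum>p\<in>\<Omega>. \<Sum>c\<in>V1. on (S x c p) x * y ^ N p)"
    by (rule sum.cong[OF refl], rule sum.swap)
  \<comment> \<open>The mark now says that \<open>c\<close> is a neighbour of \<open>snd x\<close>
    in the pulled-back graph, which holds for exactly \<open>d'\<close> choices.\<close>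
  also have "\<dots> = (\<Sum>x\<in>H. \<Sum>p\<in>\<Omega>. real d' * y ^ N p)"
  proof (rule sum.cong[OF refl], rule sum.cong[OF refl])
    fix x p assume x: "x \<in> H" and p: "p \<in> \<Omega>"
    have G: "biregular V1 V2 d d' (pullback V1 V2 p D)"
      using p by (intro biregular_pullback D) (auto simp: \<Omega>_def labellingsD)
    have "(\<Sum>c\<in>V1. on (S x c p) x * y ^ N p)
        = (\<Sum>c\<in>V1 \<inter> {c. map_prod (fst p) (snd p) (c, snd x) \<in> D}. y ^ N p)"
      unfolding on_def S_def map_prod_switch using H'(1) by (rule sum_of_bool_mult_eq)
    also have "V1 \<inter> {c. map_prod (fst p) (snd p) (c, snd x) \<in> D} = {c. (c, snd x) \<in> pullback V1 V2 p D}"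
      using x H'(3) by (auto simp: pullback_def)
    finally show "(\<Sum>c\<in>V1. on (S x c p) x * y ^ N p) = real d' * y ^ N p"
      using biregularD(10)[OF G, of "snd x"] x H'(3) by auto
  qed
  also have "\<dots> = real (card V1 * h * d') * (\<Sum>p\<in>\<Omega>. y ^ N p)"
    using biregular_card(1)[OF H] by (simp add: sum_distrib_left mult_ac)
  finally show ?thesis unfolding K_def N_def \<Omega>_def .
qed

text \<open>Switching towards a common edge: the bad set is only small on average over the choice of both
  edges \<open>x\<close> and \<open>z\<close>, so both endpoints have to move.\<close>

lemma common_deriv_ge:
  fixes y :: real and H D :: "('a \<times> 'b) set"
  assumes H: "biregular V1 V2 h h' H" and D: "biregular V1 V2 d d' D"
    and y: "0 \<le> y" "y \<le> 1"
  shows "(real (card H * card D) - real (2 * (card V2 * h' * d' * h * d) + 2 * (card V1 * h * d * h' * d')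
        + card V2 * h' * h' * d + card V1 * h * h * d')) *
      (\<Sum>p\<in>labellings V1 V2. y ^ card (common H D p))
    \<le> real (card V1 * card V2) *
      (\<Sum>p\<in>labellings V1 V2. real (card (common H D p)) * y ^ (card (common H D p) - 1))"
    (is "(_ - real ?Q) * _ \<le> _")
proof -
  note H' = biregularD[OF H] and D' = biregularD[OF D]
  define \<Omega> where "\<Omega> = labellings V1 V2"
  define N where "N p = card (common H D p)" for p
  define on :: "('a \<Rightarrow> 'a) \<times> ('b \<Rightarrow> 'b) \<Rightarrow> 'a \<times> 'b \<Rightarrow> real"
    where "on p x = of_bool (map_prod (fst p) (snd p) x \<in> D)" for p x
  define K where "K = real (card H * card D) - real ?Q"
  have N_on: "(\<Sum>x\<in>H. on p x * a) = real (N p) * a" for p a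
  proof -
    have "(\<Sum>x\<in>H. on p x * a) = (\<Sum>x\<in>H \<inter> {x. map_prod (fst p) (snd p) x \<in> D}. a)"
      using H'(4) unfolding on_def by (rule sum_of_bool_mult_eq)
    also have "H \<inter> {x. map_prod (fst p) (snd p) x \<in> D} = common H D p"
      by (auto simp: common_def)
    finally show ?thesis by (simp add: N_def)
  qed
  \<comment> \<open>Start from any labelling, pick \<open>x\<close> in \<open>H\<close> and
    \<open>z\<close> in the pulled-back \<open>D\<close>, and switch \<open>x\<close> onto
    \<open>z\<close>. A good pair gains at most one common edge, and \<open>K\<close> bounds the
    number of good pairs from below.\<close>
  have key: "K * y ^ N p \<le> (\<Sum>x\<in>H. \<Sum>z\<in>V1 \<times> V2. on p z * y ^ (N (switch x z p) - 1))"
    if p: "p \<in> \<Omega>" for p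
  proof -
    define G where "G = pullback V1 V2 p D"
    have G: "biregular V1 V2 d d' G"
      unfolding G_def using p by (intro biregular_pullback D) (auto simp: \<Omega>_def labellingsD)
    define B where "B = {((a, b), (c, e)). (a, b) \<in> H \<and> (c, e) \<in> G \<and>
      \<not> card {x \<in> H. map_prod (swp a c) (swp b e) x \<in> G} \<le> card (H \<inter> G) + 1}"
    have cB: "card B \<le> ?Q" unfolding B_def by (rule two_sided_switch_bad[OF H G])
    have finHG: "finite (H \<times> G)" using H'(4) biregularD(4)[OF G] by simp
    have BHG: "B \<subseteq> H \<times> G" by (auto simp: B_def)
    have GV: "G \<subseteq> V1 \<times> V2" using biregularD(3)[OF G] .
    have Np: "N p = card (H \<inter> G)"
      unfolding N_def G_def using H'(3) by (simp add: common_eq_pullback)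
    have good: "N (switch x z p) - 1 \<le> N p" if "(x, z) \<in> H \<times> G - B" for x z
    proof -
      have "N (switch x z p) = card {w \<in> H. map_prod (swp (fst x) (fst z)) (swp (snd x) (snd z)) w \<in> G}"
        unfolding N_def G_def using that H'(3) GV
        by (subst common_switch_eq[of H V1 V2]) auto
      moreover have "\<dots> \<le> card (H \<inter> G) + 1"
        using that by (cases x; cases z) (auto simp: B_def)
      ultimately show ?thesis using Np by simp
    qed
    have "card (H \<times> G) = card (H \<times> G - B) + card B"
      using finHG BHG by (metis card_Diff_subset card_mono finite_subset le_add_diff_inverse2)
    moreover have "card (H \<times> G) = card H * card D"
      using biregular_card(1)[OF G] biregular_card(1)[OF D] by (simp add: card_cartesian_product)
    ultimately have "K \<le> real (card (H \<times> G - B))" using cB unfolding K_def by linarith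
    then have "K * y ^ N p \<le> real (card (H \<times> G - B)) * y ^ N p"
      using y by (intro mult_right_mono) auto
    also have "\<dots> = (\<Sum>xz\<in>H \<times> G - B. y ^ N p)" by simp
    also have "\<dots> \<le> (\<Sum>xz\<in>H \<times> G - B. y ^ (N (switch (fst xz) (snd xz) p) - 1))"
      using y good by (intro sum_mono power_decreasing) auto
    also have "\<dots> \<le> (\<Sum>xz\<in>H \<times> G. y ^ (N (switch (fst xz) (snd xz) p) - 1))"
      using y finHG by (intro sum_mono2) auto
    also have "\<dots> = (\<Sum>x\<in>H. \<Sum>z\<in>G. y ^ (N (switch x z p) - 1))"
      by (subst sum.cartesian_product) (simp add: split_beta)
    \<comment> \<open>\<open>G\<close> depends on \<open>p\<close>; an indicator on the fixed range
      \<open>V1 \<times> V2\<close> lets the sums be exchanged.\<close>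
    also have "\<dots> = (\<Sum>x\<in>H. \<Sum>z\<in>V1 \<times> V2. on p z * y ^ (N (switch x z p) - 1))"
    proof (rule sum.cong[OF refl])
      fix x
      have "(\<Sum>z\<in>V1 \<times> V2. on p z * y ^ (N (switch x z p) - 1))
         = (\<Sum>z\<in>V1 \<times> V2 \<inter> {z. map_prod (fst p) (snd p) z \<in> D}. y ^ (N (switch x z p) - 1))"
        unfolding on_def by (rule sum_of_bool_mult_eq) (use H'(1,2) in auto)
      also have "V1 \<times> V2 \<inter> {z. map_prod (fst p) (snd p) z \<in> D} = G"
        by (auto simp: G_def pullback_def)
      finally show "(\<Sum>z\<in>G. y ^ (N (switch x z p) - 1)) =
          (\<Sum>z\<in>V1 \<times> V2. on p z * y ^ (N (switch x z p) - 1))" ..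
    qed
    finally show ?thesis .
  qed
  have "K * (\<Sum>p\<in>\<Omega>. y ^ N p) = (\<Sum>p\<in>\<Omega>. K * y ^ N p)"
    by (simp add: sum_distrib_left)
  also have "\<dots> \<le> (\<Sum>p\<in>\<Omega>. \<Sum>x\<in>H. \<Sum>z\<in>V1 \<times> V2. on p z * y ^ (N (switch x z p) - 1))"
    by (intro sum_mono key)
  also have "\<dots> = (\<Sum>x\<in>H. \<Sum>p\<in>\<Omega>. \<Sum>z\<in>V1 \<times> V2. on p z * y ^ (N (switch x z p) - 1))"
    by (rule sum.swap)
  also have "\<dots> = (\<Sum>x\<in>H. \<Sum>z\<in>V1 \<times> V2. \<Sum>p\<in>\<Omega>. on p z * y ^ (N (switch x z p) - 1))"
    by (rule sum.cong[OF refl], rule sum.swap)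
  \<comment> \<open>The mark on \<open>z\<close> before the switch is a mark on \<open>x\<close>
    after it. After the substitution the summand no longer depends on \<open>z\<close>, whence the
    factor \<open>card V1 * card V2\<close>.\<close>
  also have "\<dots> = (\<Sum>x\<in>H. \<Sum>z\<in>V1 \<times> V2. \<Sum>p\<in>\<Omega>. on p x * y ^ (N p - 1))"
  proof (rule sum.cong[OF refl], rule sum.cong[OF refl])
    fix x z assume "x \<in> H" "z \<in> V1 \<times> V2"
    then have "(\<Sum>p\<in>\<Omega>. on (switch x z p) x * y ^ (N (switch x z p) - 1)) = (\<Sum>p\<in>\<Omega>. on p x * y ^ (N p - 1))"
      unfolding \<Omega>_def using H'(3) by (intro sum_labellings_switch) auto
    then show "(\<Sum>p\<in>\<Omega>. on p z * y ^ (N (switch x z p) - 1)) = (\<Sum>p\<in>\<Omega>. on p x * y ^ (N p - 1))"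
      by (simp add: on_def map_prod_switch)
  qed
  also have "\<dots> = real (card V1 * card V2) * (\<Sum>x\<in>H. \<Sum>p\<in>\<Omega>. on p x * y ^ (N p - 1))"
    by (simp add: card_cartesian_product sum_distrib_left)
  also have "(\<Sum>x\<in>H. \<Sum>p\<in>\<Omega>. on p x * y ^ (N p - 1)) = (\<Sum>p\<in>\<Omega>. real (N p) * y ^ (N p - 1))"
    by (subst sum.swap) (simp add: N_on)
  finally show ?thesis unfolding K_def N_def \<Omega>_def .
qed

section \<open>Integrating the differential inequality\<close>

text \<open>With the integrating factor, \<open>F y * exp (- c * y)\<close> is nondecreasing on the
  unit interval.\<close>

lemma exp_growth_ge:
  fixes F F' :: "real \<Rightarrow> real"
  assumes der: "\<And>y. (F has_real_derivative F' y) (at y)"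
    and le: "\<And>y. 0 \<le> y \<Longrightarrow> y \<le> 1 \<Longrightarrow> c * F y \<le> F' y"
  shows "F 0 \<le> F 1 * exp (- c)"
proof -
  define g where "g y = F y * exp (- c * y)" for y
  have g: "(g has_real_derivative (F' y - c * F y) * exp (- c * y)) (at y)" for y
    unfolding g_def by (auto intro!: derivative_eq_intros der simp: algebra_simps)
  have "g 0 \<le> g 1"
  proof (rule DERIV_nonneg_imp_nondecreasing[where f = g])
    fix y :: real assume "0 \<le> y" "y \<le> 1"
    then have "0 \<le> (F' y - c * F y) * exp (- c * y)" using le[of y] by simp
    with g show "\<exists>D. (g has_real_derivative D) (at y) \<and> 0 \<le> D" by blast
  qed simp
  then show ?thesis by (simp add: g_def)
qed

lemma exp_growth_le:
  fixes F F' :: "real \<Rightarrow> real"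
  assumes der: "\<And>y. (F has_real_derivative F' y) (at y)"
    and le: "\<And>y. 0 \<le> y \<Longrightarrow> y \<le> 1 \<Longrightarrow> F' y \<le> c * F y"
  shows "F 1 * exp (- c) \<le> F 0"
proof -
  have "- F 0 \<le> - F 1 * exp (- c)"
    by (rule exp_growth_ge[where F' = "\<lambda>y. - F' y"]) (use der le in \<open>auto intro: DERIV_minus\<close>)
  then show ?thesis by simp
qed

section \<open>Two graphs\<close>

lemma labelling_pmf_eq: "labelling_pmf V1 V2 = pmf_of_set (labellings V1 V2)"
  by (simp add: labelling_pmf_def labellings_def)

text \<open>The two switching inequalities put \<open>F'\<close> within \<open>2 * M / s\<close>
  times \<open>F\<close> of \<open>M * F\<close>, where \<open>M\<close> is the mean and
  \<open>s\<close> the root of \<open>card V1\<close>. The smallness hypothesis absorbs the bad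
  switches into this error.\<close>

lemma prob_disjoint_relabel:
  fixes H D :: "('a \<times> 'b) set"
  assumes H: "biregular V1 V2 h h' H" and D: "biregular V1 V2 d d' D"
    and mn: "card V1 \<le> card V2" "V1 \<noteq> {}"
    and small: "4 * real (h' * d) \<le> sqrt (card V1)"
  defines "P \<equiv> measure_pmf.prob (labelling_pmf V1 V2) {p. relabel p H \<inter> D = {}}"
  shows "exp (- real (h' * d) - 2 * real (h' * d) / sqrt (card V1)) \<le> P"
    and "P \<le> exp (- real (h' * d) + 2 * real (h' * d) / sqrt (card V1))"
proof -
  note H' = biregularD[OF H]
  define N where "N p = card (common H D p)" for p
  define M where "M = real (h' * d)"
  define s where "s = sqrt (card V1)"
  define m n where "m = real (card V1)" and "n = real (card V2)"
  define F where "F y = (\<Sum>p\<in>labellings V1 V2. y ^ N p)" for y :: real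
  define F' where "F' y = (\<Sum>p\<in>labellings V1 V2. real (N p) * y ^ (N p - 1))" for y :: real
  have finite: "finite (labellings V1 V2)" using H' by (simp add: finite_labellings)
  have "card V1 \<ge> 1" using mn H' by (simp add: Suc_le_eq card_gt_0_iff)
  then have m: "m \<ge> 1" "n \<ge> m" using mn unfolding m_def n_def by simp_all
  have s: "s \<ge> 1" "m = s * s" using m unfolding s_def m_def by simp_all
  have M: "0 \<le> M" "4 * M \<le> s" using small by (simp_all add: M_def s_def)
  have "V2 \<noteq> {}" using mn H' by auto
  then have M': "h * d' = h' * d" using biregular_degree_products[OF H D] by simp
  have der: "(F has_real_derivative F' y) (at y)" for y
    unfolding F_def F'_def by (auto intro!: derivative_eq_intros sum.cong)
  have F1: "F 1 > 0"
    using finite labellings_nonempty[of V1 V2] by (simp add: F_def card_gt_0_iff)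
  \<comment> \<open>At zero only labellings without common edges survive, because
    \<open>0 ^ 0 = 1\<close>.\<close>
  have "F 0 = (\<Sum>p\<in>labellings V1 V2. of_bool (relabel p H \<inter> D = {}))"
    unfolding F_def
  proof (rule sum.cong[OF refl])
    fix p
    have "finite (common H D p)" using H' by (simp add: common_def)
    then have "N p = 0 \<longleftrightarrow> relabel p H \<inter> D = {}"
      unfolding N_def by (auto simp: common_def relabel_def)
    then show "0 ^ N p = (of_bool (relabel p H \<inter> D = {}) :: real)" by (simp add: power_0_left)
  qed
  also have "\<dots> = real (card (labellings V1 V2 \<inter> {p. relabel p H \<inter> D = {}}))"
    using finite by simp
  finally have P: "P = F 0 / F 1"
    unfolding P_def labelling_pmf_eq
    by (subst measure_pmf_of_set) (use finite labellings_nonempty in \<open>auto simp: F_def\<close>)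

  have le: "F' y \<le> (M + 2 * M / s) * F y" if y: "0 \<le> y" "y \<le> 1" for y
  proof -
    have "F y \<ge> 0" using y by (simp add: F_def sum_nonneg)
    \<comment> \<open>With \<open>m = s * s\<close> the two sides differ by
      \<open>2 * M * (s - M - 2 * M / s)\<close>, which is nonnegative since \<open>4 * M\<close> is
      at most \<open>s\<close> and \<open>s\<close> is at least 1.\<close>
    have c: "m * M \<le> (m - 2 * M) * (M + 2 * M / s)"
    proof -
      have "2 * M / s \<le> 1 / 2" using M s by (simp add: field_simps)
      then have "0 \<le> 2 * M * (s - M - 2 * M / s)"
        using M s by (intro mult_nonneg_nonneg) linarith+
      also have "\<dots> = (m - 2 * M) * (M + 2 * M / s) - m * M"
        using s by (simp add: field_simps)
      finally show ?thesis by simp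
    qed
    have "m \<ge> s" using s by simp
    then have pos: "m - 2 * M > 0" using M s by linarith
    have "(m - 2 * M) * F' y \<le> m * M * F y"
      using common_deriv_le[OF H D y] unfolding F_def F'_def N_def m_def M_def mult.assoc M'
      by (simp add: mult_ac)
    also have "\<dots> \<le> (m - 2 * M) * (M + 2 * M / s) * F y"
      using c \<open>F y \<ge> 0\<close> by (rule mult_right_mono)
    finally show ?thesis using pos by (simp add: mult.assoc)
  qed
  have ge: "(M - 2 * M / s) * F y \<le> F' y" if y: "0 \<le> y" "y \<le> 1" for y
  proof -
    have "F y \<ge> 0" using y by (simp add: F_def sum_nonneg)
    define Q where "Q = real (2 * (card V2 * h' * d' * h * d) + 2 * (card V1 * h * d * h' * d')
        + card V2 * h' * h' * d + card V1 * h * h * d')"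
    \<comment> \<open>Either \<open>d' = 0\<close> and \<open>M = 0\<close>, or \<open>h\<close> is
      at most \<open>h * d' = M\<close>. This makes the terms from \<open>S5\<close> and
      \<open>S6\<close> quadratic in \<open>M\<close> like the others.\<close>
    have hM: "real h * M \<le> M * M"
      unfolding M_def M'[symmetric] of_nat_mult[symmetric] of_nat_le_iff
      by (cases "d' = 0") (auto intro!: mult_le_mono1)
    have mh: "n * real h' = m * real h"
      using biregular_card[OF H] unfolding n_def m_def by (metis of_nat_mult)
    have M2: "real h * real d' = M" "real h' * real d = M"
      unfolding M_def M'[symmetric] using M' by (simp_all flip: of_nat_mult)
    have "Q = 2 * n * (real h * real d') * (real h' * real d) + 2 * m * (real h * real d') * (real h' * real d)
       + n * real h' * (real h' * real d) + m * real h * (real h * real d')"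
      unfolding Q_def n_def m_def by (simp add: mult_ac)
    also have "\<dots> = 2 * n * M * M + 2 * m * M * M + 2 * m * (real h * M)"
      unfolding M2 mh by simp
    also have "\<dots> \<le> 2 * n * M * M + 2 * m * M * M + 2 * m * (M * M)"
      using hM m by simp
    also have "\<dots> = 2 * n * (M * M) + 4 * m * (M * M)" by simp
    \<comment> \<open>Here \<open>card V1 \<le> card V2\<close> enters: the total is at most
      \<open>6 * n * M * M\<close>, and since \<open>3 * M\<close> is at most \<open>s\<close>,
      dividing by \<open>m * n\<close> leaves at most \<open>2 * M / s\<close>.\<close>
    also have "\<dots> \<le> 2 * n * (M * M) + 4 * n * (M * M)"
      using m M by (intro add_mono mult_right_mono) auto
    also have "\<dots> = 2 * n * M * (3 * M)" by simp
    also have "\<dots> \<le> 2 * n * M * s"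
      using m M by (intro mult_left_mono) auto
    also have "\<dots> = m * n * (2 * M / s)" using s by simp
    finally have Q: "Q \<le> m * n * (2 * M / s)" .
    have "real (card H * card D) = m * n * M"
      unfolding m_def n_def M_def biregular_card(2)[OF H] biregular_card(1)[OF D] by simp
    then have "m * n * (M - 2 * M / s) \<le> real (card H * card D) - Q"
      using Q by (simp add: algebra_simps)
    then have "m * n * (M - 2 * M / s) * F y \<le> (real (card H * card D) - Q) * F y"
      using \<open>F y \<ge> 0\<close> by (rule mult_right_mono)
    also have "\<dots> \<le> m * n * F' y"
      using common_deriv_ge[OF H D y] unfolding Q_def F_def F'_def N_def m_def n_def by simp
    finally have "m * n * ((M - 2 * M / s) * F y) \<le> m * n * F' y" by (simp add: mult.assoc)
    moreover have "m * n > 0" using m by simp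
    ultimately show ?thesis by (simp only: mult_le_cancel_left_pos)
  qed
  have "F 1 * exp (- (M + 2 * M / s)) \<le> F 0" by (rule exp_growth_le[OF der le])
  then show "exp (- real (h' * d) - 2 * real (h' * d) / sqrt (card V1)) \<le> P"
    unfolding P M_def[symmetric] s_def[symmetric] pos_le_divide_eq[OF F1]
    by (simp add: mult.commute)
  have "F 0 \<le> F 1 * exp (- (M - 2 * M / s))" by (rule exp_growth_ge[OF der ge])
  then show "P \<le> exp (- real (h' * d) + 2 * real (h' * d) / sqrt (card V1))"
    unfolding P M_def[symmetric] s_def[symmetric] pos_divide_le_eq[OF F1]
    by (simp add: mult.commute)
qed

section \<open>Placing the graphs one at a time\<close>

lemma biregular_UN:
  assumes "finite I" "finite V1" "finite V2" "\<And>i. i \<in> I \<Longrightarrow> biregular V1 V2 (a i) (b i) (D i)"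
    and "disjoint_family_on D I"
  shows "biregular V1 V2 (\<Sum>i\<in>I. a i) (\<Sum>i\<in>I. b i) (\<Union>i\<in>I. D i)"
  using assms
proof (induction I rule: finite_induct)
  case empty
  then show ?case by (simp add: biregular_def degree_left_def degree_right_def)
next
  case (insert i I)
  have "disjoint_family_on D I"
    using insert.prems(4) by (rule disjoint_family_on_mono[rotated]) auto
  then have IH: "biregular V1 V2 (\<Sum>i\<in>I. a i) (\<Sum>i\<in>I. b i) (\<Union>i\<in>I. D i)"
    by (intro insert.IH) (use insert.prems in auto)
  have "D i \<inter> (\<Union>i\<in>I. D i) = {}"
  proof -
    have "D i \<inter> D j = {}" if "j \<in> I" for j
      by (rule disjoint_family_onD[OF insert.prems(4)]) (use that insert.hyps in auto)
    then show ?thesis by (simp only: Int_UN_distrib) simp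
  qed
  then show ?case
    using biregular_Un[OF insert.prems(3)[of i] IH] insert.hyps by simp
qed

text \<open>Conditions on the first \<open>k\<close> labellings: the last one is independent of them
  and has to avoid the union of the graphs already placed.\<close>

lemma edge_disjoint_prob_Suc:
  "ennreal (edge_disjoint_prob V1 V2 (Suc k) D) =
    (\<integral>\<^sup>+\<omega>. ennreal (indicator {\<omega>. disjoint_family_on (\<lambda>i. relabel (\<omega> i) (D i)) {1..k}} \<omega> *
        measure_pmf.prob (labelling_pmf V1 V2)
          {p. relabel p (D (Suc k)) \<inter> (\<Union>i\<in>{1..k}. relabel (\<omega> i) (D i)) = {}})
      \<partial>measure_pmf (Pi_pmf {1..k} undefined (\<lambda>_. labelling_pmf V1 V2)))"
proof -
  let ?L = "labelling_pmf V1 V2"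
  let ?Pi = "\<lambda>k. Pi_pmf {1..k} undefined (\<lambda>_. ?L)"
  let ?E = "\<lambda>k. {\<omega>. disjoint_family_on (\<lambda>i. relabel (\<omega> i) (D i)) {1..k}}"
  have ins: "{1..Suc k} = insert (Suc k) {1..k}" by auto
  have "?Pi (Suc k) = do {y \<leftarrow> ?L; f \<leftarrow> ?Pi k; return_pmf (f(Suc k := y))}"
    unfolding ins by (rule Pi_pmf_insert') auto
  \<comment> \<open>The insertion rule draws the new coordinate first; exchanging the draws makes it
    the inner one, with \<open>f\<close> fixed.\<close>
  also have "\<dots> = do {f \<leftarrow> ?Pi k; y \<leftarrow> ?L; return_pmf (f(Suc k := y))}"
    by (rule bind_commute_pmf)
  also have "\<dots> = do {f \<leftarrow> ?Pi k; map_pmf (\<lambda>y. f(Suc k := y)) ?L}"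
    by (simp add: map_pmf_def)
  finally have "emeasure (?Pi (Suc k)) (?E (Suc k)) =
      (\<integral>\<^sup>+f. emeasure (map_pmf (\<lambda>y. f(Suc k := y)) ?L) (?E (Suc k)) \<partial>?Pi k)"
    by simp
  also have "\<dots> = (\<integral>\<^sup>+f. ennreal (indicator (?E k) f * measure_pmf.prob ?L
          {p. relabel p (D (Suc k)) \<inter> (\<Union>i\<in>{1..k}. relabel (f i) (D i)) = {}}) \<partial>?Pi k)"
  proof (rule nn_integral_cong)
    fix f :: "nat \<Rightarrow> ('a \<Rightarrow> 'a) \<times> ('b \<Rightarrow> 'b)"
    have iff: "f(Suc k := y) \<in> ?E (Suc k) \<longleftrightarrow>
       f \<in> ?E k \<and> relabel y (D (Suc k)) \<inter> (\<Union>i\<in>{1..k}. relabel (f i) (D i)) = {}" for y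
    proof -
      have "disjoint_family_on (\<lambda>i. relabel ((f(Suc k := y)) i) (D i)) {1..k} \<longleftrightarrow> f \<in> ?E k"
        by (simp add: disjoint_family_on_def)
      moreover have "(\<Union>i\<in>{1..k}. relabel ((f(Suc k := y)) i) (D i)) = (\<Union>i\<in>{1..k}. relabel (f i) (D i))"
        by (rule SUP_cong) auto
      ultimately show ?thesis
        unfolding ins mem_Collect_eq
        by (subst disjoint_family_on_insert) (simp_all add: Int_commute conj_commute)
    qed
    have "emeasure (map_pmf (\<lambda>y. f(Suc k := y)) ?L) (?E (Suc k)) =
        emeasure ?L {y. f(Suc k := y) \<in> ?E (Suc k)}"
      by (simp add: vimage_def)
    also have "\<dots> = ennreal (indicator (?E k) f * measure_pmf.prob ?L
          {p. relabel p (D (Suc k)) \<inter> (\<Union>i\<in>{1..k}. relabel (f i) (D i)) = {}})"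
      unfolding iff by (cases "f \<in> ?E k") (auto simp: measure_pmf.emeasure_eq_measure)
    finally show "emeasure (map_pmf (\<lambda>y. f(Suc k := y)) ?L) (?E (Suc k)) = \<dots>" .
  qed
  finally show ?thesis
    by (simp add: edge_disjoint_prob_def measure_pmf.emeasure_eq_measure)
qed

text \<open>By induction, a union of disjoint placed graphs is biregular with summed degrees, so
  each step is the case of two graphs. Its mean is one summand of \<open>e\<close>, and the
  exponents add.\<close>

lemma edge_disjoint_prob_bounds:
  assumes V: "finite V1" "finite V2" "card V1 \<le> card V2" "V1 \<noteq> {}"
    and D: "\<And>i. i \<in> {1..k} \<Longrightarrow> biregular V1 V2 (a i) (b i) (D i)"
    and small: "4 * real (\<Sum>i\<in>{1..k}. b i * (\<Sum>j\<in>{1..<i}. a j)) \<le> sqrt (card V1)"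
  defines "e \<equiv> real (\<Sum>i\<in>{1..k}. b i * (\<Sum>j\<in>{1..<i}. a j))"
  shows "exp (- e - 2 * e / sqrt (card V1)) \<le> edge_disjoint_prob V1 V2 k D
    \<and> edge_disjoint_prob V1 V2 k D \<le> exp (- e + 2 * e / sqrt (card V1))"
  using D small unfolding e_def
proof (induction k)
  case 0
  then show ?case by (simp add: edge_disjoint_prob_def disjoint_family_on_def)
next
  case (Suc k)
  define s where "s = sqrt (card V1)"
  define E where "E = real (\<Sum>i\<in>{1..k}. b i * (\<Sum>j\<in>{1..<i}. a j))"
  define M where "M = real (b (Suc k) * (\<Sum>j\<in>{1..k}. a j))"
  define X where "X = {\<omega>. disjoint_family_on (\<lambda>i. relabel (\<omega> i) (D i)) {1..k}}"
  define Q where "Q \<omega> = measure_pmf.prob (labelling_pmf V1 V2)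
      {p. relabel p (D (Suc k)) \<inter> (\<Union>i\<in>{1..k}. relabel (\<omega> i) (D i)) = {}}" for \<omega>
  define Pi where "Pi = Pi_pmf {1..k} undefined (\<lambda>_. labelling_pmf V1 V2)"
  define P where "P k = edge_disjoint_prob V1 V2 k D" for k
  have sum: "real (\<Sum>i\<in>{1..Suc k}. b i * (\<Sum>j\<in>{1..<i}. a j)) = E + M"
    by (simp add: E_def M_def atLeastLessThanSuc_atLeastAtMost)
  have EM: "E \<ge> 0" "M \<ge> 0" by (simp_all only: E_def M_def of_nat_0_le_iff)
  have s: "s > 0" using V by (simp add: s_def card_gt_0_iff)
  have sm: "4 * (E + M) \<le> s" using Suc.prems(2) unfolding sum s_def .
  \<comment> \<open>\<open>E\<close> and \<open>M\<close> are nonnegative, so smallness of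
    \<open>E + M\<close> passes to \<open>E\<close> here and to \<open>M\<close> in the
    step.\<close>
  have IH: "exp (- E - 2 * E / s) \<le> P k" "P k \<le> exp (- E + 2 * E / s)"
    using Suc.IH Suc.prems(1) sm EM unfolding E_def[symmetric] s_def[symmetric] P_def by auto
  have PX: "emeasure Pi X = ennreal (P k)"
    by (simp add: P_def edge_disjoint_prob_def Pi_def X_def measure_pmf.emeasure_eq_measure)
  have PS: "ennreal (P (Suc k)) = (\<integral>\<^sup>+\<omega>. ennreal (indicator X \<omega> * Q \<omega>) \<partial>Pi)"
    unfolding P_def edge_disjoint_prob_Suc X_def Q_def Pi_def ..
  have Pnn: "P j \<ge> 0" for j by (simp add: P_def edge_disjoint_prob_def)
  \<comment> \<open>Membership in the support makes each coordinate a pair of permutations, and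
    membership in \<open>X\<close> makes the placed graphs disjoint; together they make the union
    biregular.\<close>
  have Qb: "exp (- M - 2 * M / s) \<le> Q \<omega> \<and> Q \<omega> \<le> exp (- M + 2 * M / s)"
    if w: "\<omega> \<in> set_pmf Pi" and X: "\<omega> \<in> X" for \<omega>
  proof -
    have "\<omega> i \<in> labellings V1 V2" if "i \<in> {1..k}" for i
      using w that V finite_labellings[OF V(1,2)] labellings_nonempty[of V1 V2]
      by (auto simp: Pi_def set_Pi_pmf PiE_dflt_def labelling_pmf_eq)
    note w = this
    have "biregular V1 V2 (a i) (b i) (relabel (\<omega> i) (D i))" if "i \<in> {1..k}" for i
      by (rule biregular_relabel)
        (use that Suc.prems(1)[of i] labellingsD[OF w[OF that]] in auto)
    then have U: "biregular V1 V2 (\<Sum>i\<in>{1..k}. a i) (\<Sum>i\<in>{1..k}. b i) (\<Union>i\<in>{1..k}. relabel (\<omega> i) (D i))"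
      using X V unfolding X_def by (intro biregular_UN) auto
    have "biregular V1 V2 (a (Suc k)) (b (Suc k)) (D (Suc k))" using Suc.prems(1) by simp
    from prob_disjoint_relabel[OF this U V(3,4)] sm EM
    show ?thesis unfolding M_def[symmetric] s_def[symmetric] Q_def by auto
  qed
  have const: "(\<integral>\<^sup>+\<omega>. ennreal (indicator X \<omega> * c) \<partial>Pi) = ennreal (c * P k)" if "c \<ge> 0" for c
  proof -
    have "(\<integral>\<^sup>+\<omega>. ennreal (indicator X \<omega> * c) \<partial>Pi) = (\<integral>\<^sup>+\<omega>. ennreal c * indicator X \<omega> \<partial>Pi)"
      by (intro nn_integral_cong) (auto simp: indicator_def)
    also have "\<dots> = ennreal c * ennreal (P k)"
      by (subst nn_integral_cmult_indicator) (auto simp: PX)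
    finally show ?thesis using that Pnn by (simp add: ennreal_mult)
  qed
  have "ennreal (exp (- M - 2 * M / s) * P k)
      = (\<integral>\<^sup>+\<omega>. ennreal (indicator X \<omega> * exp (- M - 2 * M / s)) \<partial>Pi)"
    by (rule const[symmetric]) simp
  also have "\<dots> \<le> ennreal (P (Suc k))"
    unfolding PS
  proof (rule nn_integral_mono_AE, unfold AE_measure_pmf_iff, rule ballI, rule ennreal_leI)
    fix \<omega> assume "\<omega> \<in> set_pmf Pi"
    then show "indicator X \<omega> * exp (- M - 2 * M / s) \<le> indicator X \<omega> * Q \<omega>"
      using Qb[of \<omega>] by (cases "\<omega> \<in> X") auto
  qed
  finally have lo: "exp (- M - 2 * M / s) * P k \<le> P (Suc k)"
    using Pnn by (simp add: ennreal_le_iff)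
  have "ennreal (P (Suc k)) \<le> (\<integral>\<^sup>+\<omega>. ennreal (indicator X \<omega> * exp (- M + 2 * M / s)) \<partial>Pi)"
    unfolding PS
  proof (rule nn_integral_mono_AE, unfold AE_measure_pmf_iff, rule ballI, rule ennreal_leI)
    fix \<omega> assume "\<omega> \<in> set_pmf Pi"
    then show "indicator X \<omega> * Q \<omega> \<le> indicator X \<omega> * exp (- M + 2 * M / s)"
      using Qb[of \<omega>] by (cases "\<omega> \<in> X") auto
  qed
  also have "\<dots> = ennreal (exp (- M + 2 * M / s) * P k)"
    by (rule const) simp
  finally have hi: "P (Suc k) \<le> exp (- M + 2 * M / s) * P k"
    using Pnn by (simp add: ennreal_le_iff)
  have "exp (- (E + M) - 2 * (E + M) / s) = exp (- M - 2 * M / s) * exp (- E - 2 * E / s)"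
    unfolding exp_add[symmetric] using s by (intro arg_cong[where f = exp]) (simp add: field_simps)
  also have "\<dots> \<le> exp (- M - 2 * M / s) * P k" using IH(1) by simp
  finally have 1: "exp (- (E + M) - 2 * (E + M) / s) \<le> P (Suc k)" using lo by linarith
  have "exp (- M + 2 * M / s) * P k \<le> exp (- M + 2 * M / s) * exp (- E + 2 * E / s)"
    using IH(2) by simp
  also have "\<dots> = exp (- (E + M) + 2 * (E + M) / s)"
    unfolding exp_add[symmetric] using s by (intro arg_cong[where f = exp]) (simp add: field_simps)
  finally have 2: "P (Suc k) \<le> exp (- (E + M) + 2 * (E + M) / s)" using hi by linarith
  show ?case unfolding sum s_def[symmetric] P_def[symmetric] using 1 2 by simp
qed

section \<open>From degrees to densities and to the asymptotic form\<close>

text \<open>Groups the pairs by the larger index, the graph being placed in that step.\<close>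

lemma pair_sum_eq: "pair_sum k l = (\<Sum>i\<in>{1..k}. l i * (\<Sum>j\<in>{1..<i}. l j))"
proof -
  have "pair_sum k l = (\<Sum>(i, j)\<in>(SIGMA i:{1..k}. {1..<i}). l i * l j)"
    unfolding pair_sum_def
    by (rule sum.reindex_bij_witness[of _ prod.swap prod.swap]) (auto simp: mult.commute)
  also have "\<dots> = (\<Sum>i\<in>{1..k}. \<Sum>j\<in>{1..<i}. l i * l j)"
    by (subst sum.Sigma) auto
  finally show ?thesis by (simp add: sum_distrib_left)
qed

text \<open>The integrality conditions make the floors exact.\<close>

lemma semiregular_imp_biregular:
  assumes "semiregular_bipartite V1 V2 m n l D"
  shows "biregular V1 V2 (nat \<lfloor>l * real n\<rfloor>) (nat \<lfloor>l * real m\<rfloor>) D"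
    and "real (nat \<lfloor>l * real n\<rfloor>) = l * real n" "real (nat \<lfloor>l * real m\<rfloor>) = l * real m"
proof -
  note * = assms[unfolded semiregular_bipartite_def bipartite_graph_def]
  have floor: "real (nat \<lfloor>x\<rfloor>) = x" if "x \<in> \<int>" "0 \<le> x" for x
    using that by (auto elim!: Ints_cases)
  show n: "real (nat \<lfloor>l * real n\<rfloor>) = l * real n" and m: "real (nat \<lfloor>l * real m\<rfloor>) = l * real m"
    using * by (intro floor; simp)+
  have "degree_left D u = nat \<lfloor>l * real n\<rfloor>" if "u \<in> V1" for u
    using * that n by (metis of_nat_eq_iff)
  moreover have "degree_right D v = nat \<lfloor>l * real m\<rfloor>" if "v \<in> V2" for v
    using * that m by (metis of_nat_eq_iff)
  ultimately show "biregular V1 V2 (nat \<lfloor>l * real n\<rfloor>) (nat \<lfloor>l * real m\<rfloor>) D"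
    using * unfolding biregular_def by blast
qed

text \<open>Explicit form with constant 2. The total mean is \<open>e = m * n * S\<close>, and
  \<open>e / sqrt m = sqrt m * n * S\<close> is both the error scale and the quantity assumed
  small.\<close>

lemma semiregular_edge_disjoint_prob:
  assumes V: "finite V1" "finite V2" "card V1 = m" "card V2 = n" "m \<le> n" "m > 0"
    and D: "\<And>i. i \<in> {1..k} \<Longrightarrow> semiregular_bipartite V1 V2 m n (l i) (D i)"
    and small: "4 * (sqrt m * n * pair_sum k l) \<le> 1"
  shows "\<exists>err. edge_disjoint_prob V1 V2 k D = exp (- (real m * real n * pair_sum k l) + err) \<and>
     \<bar>err\<bar> \<le> 2 * (sqrt m * n * pair_sum k l)"
proof -
  have ne: "V1 \<noteq> {}" "V2 \<noteq> {}" using V by auto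
  define a b where "a i = nat \<lfloor>l i * real n\<rfloor>" and "b i = nat \<lfloor>l i * real m\<rfloor>" for i
  have ab: "biregular V1 V2 (a i) (b i) (D i)" "real (b i) = l i * real m" "real (a i) = l i * real n"
    if "i \<in> {1..k}" for i
    unfolding a_def b_def using semiregular_imp_biregular[OF D[OF that]] by blast+
  define e where "e = real (\<Sum>i\<in>{1..k}. b i * (\<Sum>j\<in>{1..<i}. a j))"
  define P where "P = edge_disjoint_prob V1 V2 k D"
  define S where "S = pair_sum k l"
  define s where "s = sqrt m"
  have s: "s > 0" "s * s = m" using V by (simp_all add: s_def)
  have "e = (\<Sum>i\<in>{1..k}. l i * real m * (\<Sum>j\<in>{1..<i}. l j * real n))"
    unfolding e_def of_nat_sum of_nat_mult
  proof (rule sum.cong[OF refl])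
    fix i assume i: "i \<in> {1..k}"
    have "(\<Sum>j\<in>{1..<i}. real (a j)) = (\<Sum>j\<in>{1..<i}. l j * real n)"
      by (rule sum.cong[OF refl], rule ab(3)) (use i in auto)
    then show "real (b i) * (\<Sum>j\<in>{1..<i}. real (a j)) = l i * real m * (\<Sum>j\<in>{1..<i}. l j * real n)"
      using ab(2)[OF i] by simp
  qed
  also have "\<dots> = real m * real n * S"
    unfolding S_def pair_sum_eq by (simp add: sum_distrib_left mult_ac)
  finally have e: "e = real m * real n * S" .
  have es: "e / s = s * n * S" unfolding e s(2)[symmetric] using s(1) by simp
  have "4 * (e / s) \<le> 1" using small unfolding es unfolding s_def S_def .
  then have "4 * e \<le> s" using s by (simp add: field_simps)
  then have "4 * real (\<Sum>i\<in>{1..k}. b i * (\<Sum>j\<in>{1..<i}. a j)) \<le> sqrt (card V1)"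
    unfolding e_def s_def V(3) .
  moreover have "card V1 \<le> card V2" using V by simp
  ultimately have *: "exp (- e - 2 * e / s) \<le> P \<and> P \<le> exp (- e + 2 * e / s)"
    unfolding e_def s_def P_def V(3)[symmetric]
    by (intro edge_disjoint_prob_bounds V ne ab(1))
  \<comment> \<open>The lower bound makes the logarithm meaningful; the witness for
    \<open>err\<close> is \<open>ln P + e\<close>.\<close>
  then have "P > 0" using exp_gt_zero[of "- e - 2 * e / s"] by linarith
  then have lo: "- e - 2 * e / s \<le> ln P" and hi: "ln P \<le> - e + 2 * e / s"
    using * ln_mono[of P "exp (- e + 2 * e / s)"] ln_mono[of "exp (- e - 2 * e / s)" P]
    by (simp_all only: ln_exp exp_gt_zero)
  have "2 * e / s = 2 * (s * n * S)" unfolding es[symmetric] by simp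
  then have "\<bar>ln P + e\<bar> \<le> 2 * (s * n * S)" using lo hi unfolding abs_le_iff by linarith
  moreover have "P = exp (- (real m * real n * S) + (ln P + e))"
    unfolding e using \<open>P > 0\<close> by (simp add: exp_ln)
  ultimately show ?thesis
    unfolding P_def[symmetric] S_def[symmetric] s_def[symmetric]
    by (intro exI[of _ "ln P + e"] conjI)
qed

theorem theorem3p7:
  fixes m n k :: "nat \<Rightarrow> nat"
    and V1 :: "nat \<Rightarrow> 'a set" and V2 :: "nat \<Rightarrow> 'b set"
    and l :: "nat \<Rightarrow> nat \<Rightarrow> real"
    and D :: "nat \<Rightarrow> nat \<Rightarrow> ('a \<times> 'b) set"
  assumes "filterlim n at_top sequentially"
    and "\<And>t. finite (V1 t) \<and> card (V1 t) = m t"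
    and "\<And>t. finite (V2 t) \<and> card (V2 t) = n t"
    and "\<And>t i. i \<in> {1..k t} \<Longrightarrow>
           semiregular_bipartite (V1 t) (V2 t) (m t) (n t) (l t i) (D t i)"
    and "\<And>t. m t \<le> n t"
    and "(\<lambda>t. sqrt (real (m t)) * real (n t) * pair_sum (k t) (l t)) \<in> o(\<lambda>_. 1)"
  shows "\<exists>err :: nat \<Rightarrow> real.
           err \<in> O(\<lambda>t. sqrt (real (m t)) * real (n t) * pair_sum (k t) (l t)) \<and>
           (\<forall>\<^sub>F t in sequentially.
              edge_disjoint_prob (V1 t) (V2 t) (k t) (D t) =
                exp (- (real (m t) * real (n t) * pair_sum (k t) (l t)) + err t))"
proof -
  define R where "R t = sqrt (real (m t)) * real (n t) * pair_sum (k t) (l t)" for t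
  define good where "good t err \<longleftrightarrow> edge_disjoint_prob (V1 t) (V2 t) (k t) (D t) =
      exp (- (real (m t) * real (n t) * pair_sum (k t) (l t)) + err) \<and> \<bar>err\<bar> \<le> 2 * \<bar>R t\<bar>" for t err
  \<comment> \<open>The threshold \<open>1 / 4\<close> is the smallness required by the explicit
    bound.\<close>
  have "\<forall>\<^sub>F t in sequentially. \<bar>R t\<bar> \<le> 1 / 4 * \<bar>1\<bar>"
    using landau_o.smallD[OF assms(6), of "1 / 4"] by (simp add: R_def)
  then have ev: "\<forall>\<^sub>F t in sequentially. \<exists>err. good t err"
  proof (rule eventually_mono)
    fix t assume t: "\<bar>R t\<bar> \<le> 1 / 4 * \<bar>1\<bar>"
    show "\<exists>err. good t err"
    \<comment> \<open>The explicit bound needs a nonempty left side. With \<open>V1 t\<close> empty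
      all graphs are empty, the probability is 1, and zero error works.\<close>
    proof (cases "m t = 0")
      case True
      then have "V1 t = {}" using assms(2)[of t] by (metis card_0_eq)
      then have "D t i = {}" if "i \<in> {1..k t}" for i
        using assms(4)[OF that] by (auto simp: semiregular_bipartite_def bipartite_graph_def)
      then have "{\<omega>. disjoint_family_on (\<lambda>i. relabel (\<omega> i) (D t i)) {1..k t}} = UNIV"
        by (auto simp: disjoint_family_on_def relabel_def)
      then have "edge_disjoint_prob (V1 t) (V2 t) (k t) (D t) = 1"
        by (simp add: edge_disjoint_prob_def)
      then show ?thesis using True by (intro exI[of _ 0]) (simp add: good_def)
    next
      case False
      have t': "4 * R t \<le> 1" using t by linarith
      from False obtain err where "edge_disjoint_prob (V1 t) (V2 t) (k t) (D t) =
          exp (- (real (m t) * real (n t) * pair_sum (k t) (l t)) + err)" "\<bar>err\<bar> \<le> 2 * R t"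
        using semiregular_edge_disjoint_prob[of "V1 t" "V2 t" "m t" "n t" "k t" "l t" "D t"]
          assms(2-5) t' by (auto simp: R_def)
      then show ?thesis by (intro exI[of _ err]) (auto simp: good_def)
    qed
  qed
  \<comment> \<open>Chosen for all \<open>t\<close> at once; where no good value exists it is
    arbitrary, and both claims are only about large \<open>t\<close>.\<close>
  define err where "err t = (SOME e. good t e)" for t
  have ev': "\<forall>\<^sub>F t in sequentially. good t (err t)"
    using ev unfolding err_def by eventually_elim (rule someI_ex)
  have "err \<in> O(R)"
    using ev' by (intro bigoI[of _ 2]) (auto simp: good_def elim: eventually_mono)
  moreover have "\<forall>\<^sub>F t in sequentially. edge_disjoint_prob (V1 t) (V2 t) (k t) (D t) =
      exp (- (real (m t) * real (n t) * pair_sum (k t) (l t)) + err t)"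
    using ev' by eventually_elim (simp add: good_def)
  ultimately show ?thesis unfolding R_def by blast
qed

end
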